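(* Let $V$ be a vector space of finite dimension $n$ over $\mathbb{F}_q$. Let $\mathcal{M}$ be an $\mathbb{F}_q$-subspace of $\mathrm{Symm}(V)$ in which the rank of any non-zero element is either $r$, $\ell$ or $n$, where $r$ and $\ell$ are positive integers of opposite parity satisfying $r<\ell<n$. Then, provided that $q\neq 2$, we have $\dim\mathcal{M}\leq 3n-r-2$, and $\dim\mathcal{M}_u\leq 2n-2-r$ for all non-zero $u$ in $V$.
   Context: $q$ is a power of a prime and $\mathbb{F}_q$ is the field of order $q$. $\mathrm{Symm}(V)$ denotes the $\mathbb{F}_q$-vector space of all symmetric bilinear forms $f:V\times V\to\mathbb{F}_q$. The radical of $f$ is $\mathrm{rad} f=\{u\in V: f(u,v)=0\text{ for all }v\in V\}$ and $\mathrm{rank} f=\dim V-\dim\mathrm{rad} f$. For $u\in V$, $\mathcal{M}_u=\{f\in\mathcal{M}: u\in\mathrm{rad} f\}$. *)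

theory Defs
  imports Complex_Main "HOL-Library.Function_Algebras"
begin

text \<open>
  A vector space V is given by a type \<open>'v\<close> together with a scalar multiplication \<open>scale\<close> over the
  field \<open>'k\<close>. A form on V is a function \<open>'v \<Rightarrow> 'v \<Rightarrow> 'k\<close>; addition and zero of forms are the
  pointwise ones of the imported function algebras, and scalar multiplication is the following.
\<close>

definition form_scale :: "'k::field \<Rightarrow> ('v \<Rightarrow> 'v \<Rightarrow> 'k) \<Rightarrow> ('v \<Rightarrow> 'v \<Rightarrow> 'k)" where
  "form_scale c f = (\<lambda>u v. c * f u v)"

text \<open>
  Below, \<open>forms.subspace\<close> and \<open>forms.dim\<close> are the library notions for this vector space.
\<close>

global_interpretation forms: vector_space form_scale
  by unfold_locales (simp_all add: form_scale_def fun_eq_iff distrib_left distrib_right)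

definition symm_forms :: "('k::field \<Rightarrow> 'v::ab_group_add \<Rightarrow> 'v) \<Rightarrow> ('v \<Rightarrow> 'v \<Rightarrow> 'k) set" where
  "symm_forms scale = {f.
     (\<forall>u. Vector_Spaces.linear scale (*) (\<lambda>v. f u v)) \<and>
     (\<forall>v. Vector_Spaces.linear scale (*) (\<lambda>u. f u v)) \<and>
     (\<forall>u v. f u v = f v u)}"

definition form_radical :: "('v \<Rightarrow> 'v \<Rightarrow> 'k::zero) \<Rightarrow> 'v set" where
  "form_radical f = {u. \<forall>v. f u v = 0}"

definition form_rank ::
    "('k::field \<Rightarrow> 'v::ab_group_add \<Rightarrow> 'v) \<Rightarrow> ('v \<Rightarrow> 'v \<Rightarrow> 'k) \<Rightarrow> nat" where
  "form_rank scale f =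
     vector_space.dim scale UNIV - vector_space.dim scale (form_radical f)"

definition forms_radical_at :: "('v \<Rightarrow> 'v \<Rightarrow> 'k::zero) set \<Rightarrow> 'v \<Rightarrow> ('v \<Rightarrow> 'v \<Rightarrow> 'k) set" where
  "forms_radical_at M u = {f \<in> M. u \<in> form_radical f}"

lemma symm_forms_subspace:
  assumes "vector_space scale"
  shows "forms.subspace (symm_forms scale)"
proof -
  interpret V: vector_space scale by (rule assms)
  interpret K: vector_space "(*) :: 'a \<Rightarrow> 'a \<Rightarrow> 'a"
    by unfold_locales (simp_all add: distrib_left distrib_right)
  have lin: "Vector_Spaces.linear scale (*) g \<longleftrightarrow>
      (\<forall>x y. g (x + y) = g x + g y) \<and> (\<forall>c x. g (scale c x) = c * g x)" for g :: "'b \<Rightarrow> 'a"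
    by (auto simp: Vector_Spaces.linear_def module_hom_def module_hom_axioms_def
        V.module_axioms K.module_axioms V.vector_space_axioms K.vector_space_axioms)
  show ?thesis
    unfolding forms.subspace_def symm_forms_def lin
    by (simp add: form_scale_def distrib_left mult.left_commute)
qed

end

theory Submission
  imports Defs "HOL-Library.Product_Plus" "HOL-Library.Cardinality" "HOL-Library.FuncSet"
begin

text \<open>
  Let \<open>u\<close> be a non-zero vector. The map \<open>f \<mapsto> f u\<close> from \<open>M\<close> into the dual of \<open>V\<close> has kernel \<open>M\<^sub>u\<close>,
  so the second bound implies the first (\<open>dim_le_dim_radical_at\<close>). The space \<open>N = M\<^sub>u\<close> contains no form of rank \<open>n\<close>, hence only the two
  ranks \<open>r\<close> and \<open>l\<close>, one of them odd and the other even; let \<open>A\<close> and \<open>B\<close> be the numbers of forms of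
  these ranks, and \<open>d = dim N\<close>.

  Two subsets of \<open>V \<times> V\<close> are counted. The first is the set of pairs \<open>(x, y)\<close> with \<open>f x y = 0\<close> for all
  \<open>f \<in> N\<close>. The second is the set of common zeros of the Hermitian forms \<open>h\<^sub>f\<close> that the \<open>f \<in> N\<close> induce on
  \<open>V \<otimes> K\<close>, where \<open>K\<close> is the quadratic extension of the base field and \<open>V \<otimes> K\<close> is identified with
  \<open>V \<times> V\<close>. A single form of rank \<open>k\<close> has \<open>(q^(2n) + (q - 1) w) / q\<close> zeros on \<open>V \<times> V\<close>, where
  \<open>w = q^(2n - k)\<close> for \<open>f\<close> itself (\<open>card_form_zeros\<close>) and \<open>w = (-1)^k q^(2n - k)\<close> for \<open>h\<^sub>f\<close>
  (\<open>card_hermitian_zeros\<close>). Since \<open>f x y\<close> and \<open>h\<^sub>f (x, y)\<close> are linear in \<open>f\<close>, double counting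
  (\<open>card_common_zeros\<close>) shows that \<open>q^d\<close> times the number of common zeros is, in the two cases,
  \<open>q^(2n) + A q^(2n - r) + B q^(2n - l)\<close> and
  \<open>q^(2n) + (-1)^r A q^(2n - r) + (-1)^l B q^(2n - l)\<close>.

  Both sets are invariant under translation by \<open>(a u, b u)\<close>, so their sizes are divisible by \<open>q^2\<close>.
  If \<open>d\<close> exceeds the asserted bound, then both sums, like the term \<open>q^(2n)\<close> in them, are divisible by
  \<open>q^(2n + 1 - r)\<close>. As \<open>r\<close> and \<open>l\<close> have opposite parity, the sum and the difference of the two separate \<open>A\<close> from \<open>B\<close> and give
  \<open>q dvd 2 A\<close> and \<open>q dvd 2 B\<close>. But \<open>A + B = q^d - 1\<close>, so \<open>q dvd 2\<close>, that is \<open>q = 2\<close>.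
\<close>

section \<open>Fibres of additive and quadratic maps\<close>

lemma dvd_card_of_orbit_sizes:
  fixes k :: nat
  assumes fin: "finite S"
    and refl: "\<And>x. x \<in> S \<Longrightarrow> x \<in> orb x" and sub: "\<And>x. x \<in> S \<Longrightarrow> orb x \<subseteq> S"
    and eq: "\<And>x y. x \<in> S \<Longrightarrow> y \<in> orb x \<Longrightarrow> orb y = orb x"
    and size: "\<And>x. x \<in> S \<Longrightarrow> card (orb x) = k"
  shows "k dvd card S"
proof -
  have S: "\<Union>(orb ` S) = S" using refl sub by blast
  have "k * card (orb ` S) = card (\<Union>(orb ` S))"
  proof (rule card_partition)
    fix c1 c2 assume "c1 \<in> orb ` S" "c2 \<in> orb ` S" "c1 \<noteq> c2"
    then show "c1 \<inter> c2 = {}" using eq by blast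
  qed (use fin S size in auto)
  then show ?thesis using S by (metis dvd_triv_left)
qed

lemma card_additive_fibre:
  fixes g :: "'a::ab_group_add \<Rightarrow> 'k::{field,finite}"
  assumes fin: "finite G"
    and plus: "\<And>x y. x \<in> G \<Longrightarrow> y \<in> G \<Longrightarrow> x + y \<in> G"
    and minus: "\<And>x y. x \<in> G \<Longrightarrow> y \<in> G \<Longrightarrow> x - y \<in> G"
    and add: "\<And>x y. x \<in> G \<Longrightarrow> y \<in> G \<Longrightarrow> g (x + y) = g x + g y"
    and onto: "\<And>c. \<exists>x\<in>G. g x = c"
  shows "CARD('k) * card {x \<in> G. g x = c} = card G"
proof -
  have *: "card {x \<in> G. g x = c} = card {x \<in> G. g x = 0}" for c
  proof -
    obtain a where a: "a \<in> G" "g a = c" using onto by blast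
    have "bij_betw (\<lambda>x. x + a) {x \<in> G. g x = 0} {x \<in> G. g x = c}"
    proof (rule bij_betw_byWitness[where f' = "\<lambda>x. x - a"])
      have "g (x - a) = 0" if "x \<in> G" "g x = c" for x
        using add[of "x - a" a] minus[OF that(1) a(1)] that a by simp
      then show "(\<lambda>x. x - a) ` {x \<in> G. g x = c} \<subseteq> {x \<in> G. g x = 0}"
        using minus a by auto
    qed (use plus add a in auto)
    then show ?thesis by (rule bij_betw_same_card[symmetric])
  qed
  have "card G = (\<Sum>c\<in>UNIV. card {x \<in> G. g x = c})"
    using sum.group[OF fin, of "UNIV :: 'k set" g "\<lambda>_. 1::nat"] by simp
  also have "\<dots> = (\<Sum>c\<in>(UNIV::'k set). card {x \<in> G. g x = 0})"
    by (rule sum.cong[OF refl], rule *)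
  finally show ?thesis unfolding *[of c] by simp
qed

text \<open>
  The sum on the left counts pairs \<open>(z, z')\<close> with \<open>h z = h z'\<close>. Substituting \<open>z' = z + t\<close> turns the
  condition into \<open>b t z = - h t\<close>, which for fixed \<open>t\<close> holds for every \<open>z\<close> or for one \<open>z\<close> in \<open>q\<close>.
  In terms of characters, \<open>q\<close> times this number is the sum of the squared moduli of the Gauss sums of
  \<open>h\<close> over all additive characters of the field.
\<close>

lemma sum_squares_fibres:
  fixes h :: "'w::ab_group_add \<Rightarrow> 'k::{field,finite}"
  assumes fin: "finite (UNIV :: 'w set)"
    and polar: "\<And>t z. h (z + t) = h z + h t + b t z"
    and add: "\<And>t y z. b t (y + z) = b t y + b t z"
    and onto: "\<And>t c. t \<notin> K \<Longrightarrow> \<exists>z. b t z = c"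
    and rad: "\<And>t. t \<in> K \<Longrightarrow> h t = 0" "\<And>t z. t \<in> K \<Longrightarrow> b t z = 0"
  shows "int (CARD('k)) * (\<Sum>c\<in>UNIV. (int (card {z. h z = c}))\<^sup>2) =
     int (card (UNIV :: 'w set)) *
     (int (CARD('k)) * int (card K) + int (card (UNIV :: 'w set)) - int (card K))"
proof -
  let ?q = "int (CARD('k))" and ?W = "int (card (UNIV :: 'w set))"
  have finA: "finite A" for A :: "'w set" by (rule finite_subset[OF subset_UNIV fin])
  have count: "int (card {z. P z}) = (\<Sum>z\<in>UNIV. of_bool (P z))" for P :: "'w \<Rightarrow> bool"
    using fin by simp
  have "(int (card {z. h z = c}))\<^sup>2 = (\<Sum>z | z \<in> UNIV \<and> h z = c. int (card {y. h y = h z}))" for c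
  proof -
    have "(\<Sum>z | z \<in> UNIV \<and> h z = c. int (card {y. h y = h z}))
        = (\<Sum>z | z \<in> UNIV \<and> h z = c. int (card {y. h y = c}))"
      by (rule sum.cong) simp_all
    then show ?thesis by (simp add: power2_eq_square)
  qed
  then have "(\<Sum>c\<in>UNIV. (int (card {z. h z = c}))\<^sup>2)
      = (\<Sum>c\<in>UNIV. \<Sum>z | z \<in> UNIV \<and> h z = c. int (card {y. h y = h z}))"
    by (simp only:)
  also have "\<dots> = (\<Sum>z\<in>UNIV. int (card {y. h y = h z}))"
    by (rule sum.group[OF fin]) simp_all
  also have "\<dots> = (\<Sum>z\<in>UNIV. int (card {t. h t + b t z = 0}))"
  proof (rule sum.cong)
    fix z
    have eq: "h (z + t) = h z \<longleftrightarrow> h t + b t z = 0" for t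
      by (simp add: polar[of z t] add.assoc)
    have "bij_betw (\<lambda>t. z + t) {t. h t + b t z = 0} {y. h y = h z}"
    proof (rule bij_betw_byWitness[where f' = "\<lambda>y. y - z"])
      show "(\<lambda>y. y - z) ` {y. h y = h z} \<subseteq> {t. h t + b t z = 0}"
        using eq[of "y - z" for y] by auto
    qed (auto simp: eq)
    from bij_betw_same_card[OF this]
    show "int (card {y. h y = h z}) = int (card {t. h t + b t z = 0})"
      by simp
  qed simp
  also have "\<dots> = (\<Sum>t\<in>UNIV. int (card {z. h t + b t z = 0}))"
    unfolding count by (rule sum.swap)
  finally have S: "(\<Sum>c\<in>UNIV. (int (card {z. h z = c}))\<^sup>2)
      = (\<Sum>t\<in>UNIV. int (card {z. h t + b t z = 0}))" .
  have "?q * int (card {z. h t + b t z = 0}) = (if t \<in> K then ?q * ?W else ?W)" for t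
  proof (cases "t \<in> K")
    case False
    have "CARD('k) * card {z \<in> UNIV. b t z = - h t} = card (UNIV::'w set)"
      by (rule card_additive_fibre) (simp_all add: fin add onto[OF False])
    moreover have "{z. h t + b t z = 0} = {z \<in> UNIV. b t z = - h t}"
      by (auto simp: add_eq_0_iff)
    ultimately show ?thesis using False by (metis of_nat_mult)
  qed (use rad in auto)
  then have "?q * (\<Sum>c\<in>UNIV. (int (card {z. h z = c}))\<^sup>2)
      = (\<Sum>t\<in>UNIV. if t \<in> K then ?q * ?W else ?W)"
    unfolding S sum_distrib_left by simp
  also have "\<dots> = (\<Sum>t\<in>K. ?q * ?W) + (\<Sum>t\<in>-K. ?W)"
    using fin by (simp add: sum.If_cases)
  also have "\<dots> = int (card K) * (?q * ?W) + (?W - int (card K)) * ?W"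
    using finA[of K] fin card_mono[OF fin, of K] by (simp add: Compl_eq_Diff_UNIV card_Diff_subset of_nat_diff)
  finally show ?thesis by (simp add: algebra_simps)
qed

section \<open>Finite vector spaces\<close>

lemma field_card_gt_1: "CARD('k::{field,finite}) > 1"
proof -
  have "card {0, 1 :: 'k} \<le> CARD('k)" by (rule card_mono) auto
  then show ?thesis by simp
qed

locale finite_space = vector_space scale
  for scale :: "'k::{field,finite} \<Rightarrow> 'v::ab_group_add \<Rightarrow> 'v" +
  assumes finite_UNIV: "finite (UNIV :: 'v set)"
begin

lemma finite_vectors [simp]: "finite (A :: 'v set)"
  by (rule finite_subset[OF subset_UNIV finite_UNIV])

lemma card_subspace:
  assumes "subspace S"
  shows "card S = CARD('k) ^ dim S"
proof -
  obtain C where C: "C \<subseteq> S" "independent C" "S \<subseteq> span C" "card C = dim S"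
    using basis_exists by blast
  have "span C = S" using C(1,3) assms span_minimal by blast
  then have S: "S = range (\<lambda>u. \<Sum>v\<in>C. scale (u v) v)"
    using span_finite[OF finite_vectors[of C]] by simp
  have "bij_betw (\<lambda>u. \<Sum>v\<in>C. scale (u v) v) (C \<rightarrow>\<^sub>E UNIV) S"
    unfolding bij_betw_def
  proof
    show "inj_on (\<lambda>u. \<Sum>v\<in>C. scale (u v) v) (C \<rightarrow>\<^sub>E UNIV)"
    proof (rule inj_onI)
      fix u w assume u: "u \<in> C \<rightarrow>\<^sub>E UNIV" and w: "w \<in> C \<rightarrow>\<^sub>E UNIV"
        and "(\<Sum>v\<in>C. scale (u v) v) = (\<Sum>v\<in>C. scale (w v) v)"
      then have "(\<Sum>v\<in>C. scale (u v - w v) v) = 0"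
        by (simp add: scale_left_diff_distrib sum_subtractf)
      then have "u v - w v = 0" if "v \<in> C" for v
        using independentD[OF C(2), of C "\<lambda>v. u v - w v"] that by simp
      then show "u = w" by (intro PiE_ext[OF u w]) simp
    qed
    show "(\<lambda>u. \<Sum>v\<in>C. scale (u v) v) ` (C \<rightarrow>\<^sub>E UNIV) = S"
    proof
      show "S \<subseteq> (\<lambda>u. \<Sum>v\<in>C. scale (u v) v) ` (C \<rightarrow>\<^sub>E UNIV)"
      proof
        fix x assume "x \<in> S"
        then obtain u where "x = (\<Sum>v\<in>C. scale (u v) v)" unfolding S by blast
        then have "x = (\<Sum>v\<in>C. scale (restrict u C v) v)" by simp
        then show "x \<in> (\<lambda>u. \<Sum>v\<in>C. scale (u v) v) ` (C \<rightarrow>\<^sub>E UNIV)"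
          by (intro image_eqI[where x = "restrict u C"]) simp_all
      qed
      show "(\<lambda>u. \<Sum>v\<in>C. scale (u v) v) ` (C \<rightarrow>\<^sub>E UNIV) \<subseteq> S"
        unfolding S by blast
    qed
  qed
  then have "card S = card (C \<rightarrow>\<^sub>E (UNIV :: 'k set))"
    by (rule bij_betw_same_card[symmetric])
  then show ?thesis using C(4) by (simp add: card_PiE)
qed

end

lemma finite_space_field: "finite_space ((*) :: 'k::{field,finite} \<Rightarrow> 'k \<Rightarrow> 'k)"
  by unfold_locales (simp_all add: distrib_left distrib_right)

lemma finite_space_of_finite_dimensional:
  fixes scale :: "'k::{field,finite} \<Rightarrow> 'v::ab_group_add \<Rightarrow> 'v"
  assumes "finite_dimensional_vector_space scale B"
  shows "finite_space scale"
proof -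
  interpret finite_dimensional_vector_space scale B by (rule assms)
  have "UNIV = range (\<lambda>u. \<Sum>v\<in>B. scale (u v) v)"
    using span_finite[OF finite_Basis] span_Basis by simp
  also have "\<dots> \<subseteq> (\<lambda>u. \<Sum>v\<in>B. scale (u v) v) ` (B \<rightarrow>\<^sub>E UNIV)"
  proof (rule image_subsetI)
    fix u :: "'v \<Rightarrow> 'k"
    show "(\<Sum>v\<in>B. scale (u v) v) \<in> (\<lambda>u. \<Sum>v\<in>B. scale (u v) v) ` (B \<rightarrow>\<^sub>E UNIV)"
      by (intro image_eqI[where x = "restrict u B"]) simp_all
  qed
  finally have "finite (UNIV :: 'v set)"
    by (rule finite_subset) (simp add: finite_PiE finite_Basis)
  then show ?thesis by unfold_locales
qed

section \<open>Symmetric forms and their radicals\<close>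

lemma symm_formsD:
  assumes "f \<in> symm_forms scale"
  shows "f (x + y) z = f x z + f y z" "f x (y + z) = f x y + f x z"
    and "f (scale c x) z = c * f x z" "f x (scale c z) = c * f x z"
    and "f x y = f y x" "f 0 y = 0" "f x 0 = 0"
proof -
  have l: "Vector_Spaces.linear scale (*) (f x)" "Vector_Spaces.linear scale (*) (\<lambda>x. f x z)" for x z
    using assms by (auto simp: symm_forms_def)
  from l have *: "f (x + y) z = f x z + f y z" "f x (y + z) = f x y + f x z" for x y z
    by (auto simp: Vector_Spaces.linear_def module_hom_def module_hom_axioms_def)
  from l show "f (scale c x) z = c * f x z" "f x (scale c z) = c * f x z"
    by (auto simp: Vector_Spaces.linear_def module_hom_def module_hom_axioms_def)
  show "f x y = f y x" using assms by (auto simp: symm_forms_def)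
  show "f (x + y) z = f x z + f y z" "f x (y + z) = f x y + f x z" by (fact *)+
  show "f 0 y = 0" "f x 0 = 0"
    using *(1)[of 0 0 y] *(2)[of x 0 0] by (simp_all only: add_0_left add_cancel_right_right)
qed

lemma mult_symm_form: "(*) \<in> symm_forms ((*) :: 'k::{field,finite} \<Rightarrow> 'k \<Rightarrow> 'k)"
proof -
  have V: "vector_space ((*) :: 'k \<Rightarrow> 'k \<Rightarrow> 'k)"
    using finite_space_field finite_space_def by blast
  have "Vector_Spaces.linear (*) (*) ((*) x)" "Vector_Spaces.linear (*) (*) (\<lambda>y. y * x)" for x :: 'k
    by (auto simp: Vector_Spaces.linear_def module_hom_def module_hom_axioms_def
        V V[folded module_iff_vector_space] algebra_simps)
  then show ?thesis by (simp add: symm_forms_def mult.commute)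
qed

context finite_space
begin

lemma subspace_radical:
  assumes f: "f \<in> symm_forms scale" shows "subspace (form_radical f)"
  by (rule subspaceI) (auto simp: form_radical_def symm_formsD[OF f])

lemma card_radical:
  assumes f: "f \<in> symm_forms scale"
  shows "form_rank scale f \<le> dim (UNIV :: 'v set)"
    and "card (form_radical f) = CARD('k) ^ (dim (UNIV :: 'v set) - form_rank scale f)"
    and "card (UNIV :: 'v set) = CARD('k) ^ dim (UNIV :: 'v set)"
proof -
  show V: "card (UNIV :: 'v set) = CARD('k) ^ dim (UNIV :: 'v set)"
    using card_subspace[OF subspace_UNIV] .
  have R: "card (form_radical f) = CARD('k) ^ dim (form_radical f)"
    using card_subspace[OF subspace_radical[OF f]] .
  have "card (form_radical f) \<le> card (UNIV :: 'v set)" by (rule card_mono) auto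
  then have "dim (form_radical f) \<le> dim (UNIV :: 'v set)"
    unfolding V R using power_le_imp_le_exp[OF field_card_gt_1] by blast
  then show "form_rank scale f \<le> dim (UNIV :: 'v set)"
    and "card (form_radical f) = CARD('k) ^ (dim (UNIV :: 'v set) - form_rank scale f)"
    using R by (simp_all add: form_rank_def)
qed

text \<open>
  For \<open>x\<close> in the radical every \<open>y\<close> counts, and for any other \<open>x\<close> one \<open>y\<close> in \<open>q\<close>.
\<close>

lemma card_form_zeros:
  assumes f: "f \<in> symm_forms scale"
  defines "n \<equiv> dim (UNIV :: 'v set)" and "r \<equiv> form_rank scale f" and "q \<equiv> int CARD('k)"
  shows "q * int (card {(x, y). f x y = 0}) = q ^ (2 * n) + (q - 1) * q ^ (2 * n - r)"
proof -
  note D = symm_formsD[OF f]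
  let ?R = "form_radical f"
  have rn: "r \<le> n" using card_radical(1)[OF f] by (simp add: r_def n_def)
  have V: "int (card (UNIV :: 'v set)) = q ^ n" and R: "int (card ?R) = q ^ (n - r)"
    using card_radical(2,3)[OF f] by (simp_all add: q_def n_def r_def)
  have fibre: "q * int (card {y. f x y = 0}) = (if x \<in> ?R then q * q ^ n else q ^ n)" for x
  proof (cases "x \<in> ?R")
    case True
    then have "{y. f x y = 0} = UNIV" by (auto simp: form_radical_def)
    then show ?thesis using True V by simp
  next
    case False
    then obtain y where y: "f x y \<noteq> 0" by (auto simp: form_radical_def)
    have "\<exists>z\<in>UNIV. f x z = c" for c
      using y by (intro bexI[of _ "scale (c / f x y) y"]) (simp_all add: D)
    then have "CARD('k) * card {z \<in> UNIV. f x z = 0} = card (UNIV :: 'v set)"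
      by (intro card_additive_fibre) (simp_all add: D)
    then have "int (CARD('k) * card {z. f x z = 0}) = int (card (UNIV :: 'v set))" by simp
    then have "q * int (card {z. f x z = 0}) = q ^ n" by (simp only: V of_nat_mult q_def)
    then show ?thesis using False by simp
  qed
  have "{(x, y). f x y = 0} = (SIGMA x:UNIV. {y. f x y = 0})" by auto
  then have "card {(x, y). f x y = 0} = (\<Sum>x\<in>UNIV. card {y. f x y = 0})" by simp
  then have "q * int (card {(x, y). f x y = 0}) = (\<Sum>x\<in>UNIV. if x \<in> ?R then q * q ^ n else q ^ n)"
    by (simp add: sum_distrib_left fibre)
  also have "\<dots> = int (card ?R) * (q * q ^ n) + int (card (- ?R)) * q ^ n"
    by (simp add: sum.If_cases)
  also have "int (card (- ?R)) = q ^ n - q ^ (n - r)"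
    using card_mono[OF finite_UNIV, of ?R]
    by (simp add: Compl_eq_Diff_UNIV card_Diff_subset of_nat_diff V R)
  finally have "q * int (card {(x, y). f x y = 0}) = q ^ n * q ^ n + (q - 1) * (q ^ n * q ^ (n - r))"
    unfolding R by (simp add: algebra_simps)
  also have "q ^ n * q ^ n = q ^ (2 * n)" by (simp add: mult_2 power_add)
  also have "q ^ n * q ^ (n - r) = q ^ (2 * n - r)" using rn by (simp add: mult_2 flip: power_add)
  finally show ?thesis .
qed

end

section \<open>Hermitian forms over the quadratic extension\<close>

text \<open>
  In every finite field \<open>x\<^sup>2 + x\<close> takes the same value at \<open>0\<close> and \<open>- 1\<close>, so it omits some \<open>\<gamma>\<close>. Then
  \<open>X\<^sup>2 - X - \<gamma>\<close> is irreducible, in odd and in even characteristic alike, and a root \<open>\<omega>\<close> of it generates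
  the quadratic extension.
\<close>

lemma artin_schreier_not_surjective: "\<exists>\<gamma>::'k::{field,finite}. \<forall>x. x * x + x \<noteq> \<gamma>"
proof (rule ccontr)
  assume "\<not> ?thesis"
  then have "surj (\<lambda>x::'k. x * x + x)" by (auto simp: surj_def) metis
  then have "inj (\<lambda>x::'k. x * x + x)" using finite_UNIV_surj_inj finite by blast
  from injD[OF this, of 0 "- 1"] show False by simp
qed

text \<open>
  The discriminant of \<open>X\<^sup>2 - X - \<gamma>\<close>: in odd characteristic a double root would be rational, and in
  characteristic 2 the discriminant is \<open>1\<close>.
\<close>

lemma discriminant_nonzero:
  fixes \<gamma> :: "'k::{field,finite}"
  assumes \<gamma>: "\<And>x. x * x + x \<noteq> \<gamma>"
  shows "1 + 4 * \<gamma> \<noteq> 0"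
proof
  assume *: "1 + 4 * \<gamma> = 0"
  have 2: "(2::'k) \<noteq> 0"
  proof
    assume "(2::'k) = 0"
    then have "(4::'k) = 0" by (metis mult_zero_left numeral_Bit0_eq_double)
    with * show False by simp
  qed
  have "(2::'k) * 2 = 4" by simp
  then have 4: "(4::'k) \<noteq> 0" using 2 by (metis mult_eq_0_iff)
  define x where "x = - 1 / (2::'k)"
  have "2 * x = - 1" using 2 by (simp add: x_def)
  then have "4 * (x * x + x) = 4 * \<gamma>" using * by algebra
  then have "x * x + x = \<gamma>" using mult_left_cancel[OF 4] by blast
  then show False using \<gamma> by blast
qed

text \<open>
  With \<open>\<omega>\<^sup>2 = \<omega> + \<gamma>\<close> and the conjugate \<open>1 - \<omega>\<close> of \<open>\<omega>\<close>, this is the value \<open>f (z, z')\<close> of the extension of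
  \<open>f\<close> to the quadratic extension at \<open>z = x + \<omega> y\<close> and its conjugate \<open>z'\<close>. For \<open>f\<close> the multiplication
  of the base field, it is the norm of \<open>x + \<omega> y\<close>.
\<close>

definition hermitian :: "'k::{field,finite} \<Rightarrow> ('v \<Rightarrow> 'v \<Rightarrow> 'k) \<Rightarrow> 'v \<times> 'v \<Rightarrow> 'k" where
  "hermitian \<gamma> f = (\<lambda>(x, y). f x x + f x y - \<gamma> * f y y)"

text \<open>
  The product of \<open>a + b \<omega>\<close> and \<open>x + \<omega> y\<close>, in coordinates. For \<open>scale = (*)\<close> it is the multiplication of
  the quadratic extension.
\<close>

definition ext_scale ::
    "'k::field \<Rightarrow> ('k \<Rightarrow> 'v::ab_group_add \<Rightarrow> 'v) \<Rightarrow> 'k \<times> 'k \<Rightarrow> 'v \<times> 'v \<Rightarrow> 'v \<times> 'v" where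
  "ext_scale \<gamma> scale = (\<lambda>(a, b) (x, y).
     (scale a x + scale (\<gamma> * b) y, scale b x + scale (a + b) y))"

text \<open>
  The norm is anisotropic: the quotient of the coordinates of a zero would be a root of
  \<open>X\<^sup>2 + X = \<gamma>\<close>.
\<close>

lemma norm_eq_0_imp:
  assumes \<gamma>: "\<And>x. x * x + x \<noteq> \<gamma>" and "hermitian \<gamma> (*) s = 0"
  shows "s = 0"
proof -
  obtain a b where [simp]: "s = (a, b)" by (cases s)
  have 0: "a * a + a * b - \<gamma> * (b * b) = 0" using assms(2) by (simp add: hermitian_def)
  have "b = 0"
  proof (rule ccontr)
    assume "b \<noteq> 0"
    then have "(a / b) * (a / b) + a / b = \<gamma>" using 0 by (simp add: field_simps)
    then show False using \<gamma> by blast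
  qed
  then show ?thesis using 0 by (simp add: zero_prod_def)
qed

context finite_space
begin

text \<open>
  The polar form of the Hermitian form of \<open>f\<close> has radical \<open>R \<times> R\<close>, where \<open>R\<close> is the radical of \<open>f\<close>, because
  \<open>X\<^sup>2 - X - \<gamma>\<close> is separable.
\<close>

lemma sum_squares_hermitian:
  assumes f: "f \<in> symm_forms scale" and \<gamma>: "\<And>x. x * x + x \<noteq> \<gamma>"
  defines "W \<equiv> (int (card (UNIV :: 'v set)))\<^sup>2" and "K \<equiv> (int (card (form_radical f)))\<^sup>2"
  shows "int CARD('k) * (\<Sum>c\<in>UNIV. (int (card {z. hermitian \<gamma> f z = c}))\<^sup>2) =
    W * (int CARD('k) * K + W - K)"
proof -
  note D = symm_formsD[OF f]
  let ?R = "form_radical f"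
  \<comment> \<open>the polarization of the Hermitian form\<close>
  define b where "b = (\<lambda>(t1, t2) (z1, z2). 2 * f t1 z1 + f t2 z1 + f t1 z2 - 2 * \<gamma> * f t2 z2)"
  have "int CARD('k) * (\<Sum>c\<in>UNIV. (int (card {z. hermitian \<gamma> f z = c}))\<^sup>2) =
     int (card (UNIV :: ('v \<times> 'v) set)) *
     (int CARD('k) * int (card (?R \<times> ?R)) + int (card (UNIV :: ('v \<times> 'v) set)) - int (card (?R \<times> ?R)))"
  proof (rule sum_squares_fibres[where b = b])
    show "finite (UNIV :: ('v \<times> 'v) set)" by (simp add: finite_prod)
    show "hermitian \<gamma> f (z + t) = hermitian \<gamma> f z + hermitian \<gamma> f t + b t z" for t z
      using D(5)[of "fst z" "fst t"] D(5)[of "fst z" "snd t"] D(5)[of "snd z" "snd t"]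
      by (cases z; cases t) (simp add: hermitian_def b_def D(1,2) algebra_simps)
    show "b t (y + z) = b t y + b t z" for t y z
      by (cases z; cases t; cases y) (simp add: b_def D algebra_simps)
    show "\<exists>z. b t z = c" if t: "t \<notin> ?R \<times> ?R" for t c
    proof -
      obtain t1 t2 where [simp]: "t = (t1, t2)" by (cases t)
      from t obtain y where y: "f t1 y \<noteq> 0 \<or> f t2 y \<noteq> 0" by (auto simp: form_radical_def)
      let ?A = "2 * f t1 y + f t2 y" and ?B = "f t1 y - 2 * \<gamma> * f t2 y"
      \<comment> \<open>the coefficient matrix of \<open>?A\<close>, \<open>?B\<close> is invertible, with determinant \<open>- (1 + 4 * \<gamma>)\<close>\<close>
      have e: "(1 + 4 * \<gamma>) * f t1 y = 2 * \<gamma> * ?A + ?B" "(1 + 4 * \<gamma>) * f t2 y = ?A - 2 * ?B"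
        by (simp_all add: algebra_simps)
      consider "?A \<noteq> 0" | "?B \<noteq> 0"
      proof (rule ccontr)
        assume "\<not> thesis"
        then have "?A = 0" "?B = 0" using that by blast+
        then have "(1 + 4 * \<gamma>) * f t1 y = 0" "(1 + 4 * \<gamma>) * f t2 y = 0"
          unfolding e by (simp_all only: mult_zero_right add_0_left diff_0_right)
        then show False using y discriminant_nonzero[OF \<gamma>] by (metis mult_eq_0_iff)
      qed
      then show ?thesis
      proof cases
        case 1
        have "b t (scale (c / ?A) y, 0) = (c / ?A) * ?A" unfolding distrib_left by (simp add: b_def D mult_ac)
        with 1 show ?thesis by auto
      next
        case 2
        have "b t (0, scale (c / ?B) y) = (c / ?B) * ?B" unfolding right_diff_distrib by (simp add: b_def D mult_ac)
        with 2 show ?thesis by auto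
      qed
    qed
    show "hermitian \<gamma> f t = 0" if "t \<in> ?R \<times> ?R" for t
      using that by (auto simp: hermitian_def form_radical_def)
    show "b t z = 0" if "t \<in> ?R \<times> ?R" for t z
      using that by (auto simp: b_def form_radical_def split: prod.splits)
  qed
  then show ?thesis
    by (simp add: W_def K_def card_cartesian_product power2_eq_square flip: UNIV_Times_UNIV)
qed

end

text \<open>
  Write \<open>n c\<close> for the number of elements of norm \<open>c\<close>. The sum of \<open>n c\<close> and, by
  \<open>sum_squares_hermitian\<close>, that of its square are known, and \<open>n 0 = 1\<close>. The variance of \<open>n c\<close> over
  \<open>c \<noteq> 0\<close> turns out to be zero, so all these \<open>n c\<close> equal \<open>q + 1\<close>.
\<close>

lemma norm_surjective:
  fixes \<gamma> :: "'k::{field,finite}"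
  assumes \<gamma>: "\<And>x. x * x + x \<noteq> \<gamma>" and c: "c \<noteq> 0"
  obtains s where "hermitian \<gamma> (*) s = c"
proof -
  let ?q = "int CARD('k)"
  define n where "n c = int (card {s. hermitian \<gamma> (*) s = c})" for c
  have "form_radical (*) = {0 :: 'k}" by (auto simp: form_radical_def dest: spec[of _ 1])
  then have "?q * (\<Sum>c\<in>UNIV. (n c)\<^sup>2) = ?q * (?q * (?q + ?q\<^sup>2 - 1))"
    using finite_space.sum_squares_hermitian[OF finite_space_field mult_symm_form \<gamma>] by (simp add: n_def power2_eq_square)
  then have sq: "(\<Sum>c\<in>UNIV. (n c)\<^sup>2) = ?q * (?q + ?q\<^sup>2 - 1)" by simp
  have "card (UNIV :: ('k \<times> 'k) set) = (\<Sum>c\<in>UNIV. card {s. hermitian \<gamma> (*) s = c})"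
    using sum.group[of "UNIV :: ('k \<times> 'k) set" "UNIV :: 'k set" "hermitian \<gamma> (*)" "\<lambda>_. 1::nat"] by simp
  then have sm: "(\<Sum>c\<in>UNIV. n c) = ?q\<^sup>2"
    by (simp add: n_def power2_eq_square flip: of_nat_sum of_nat_mult)
  have "{s. hermitian \<gamma> (*) s = 0} = {0}"
    using norm_eq_0_imp[OF \<gamma>] by (auto simp: hermitian_def zero_prod_def)
  then have n0: "n 0 = 1" by (simp add: n_def)
  have "(n c - (?q + 1))\<^sup>2 = (n c)\<^sup>2 - 2 * (?q + 1) * n c + (?q + 1)\<^sup>2" for c
    by (simp add: power2_diff)
  then have "(\<Sum>c\<in>UNIV. (n c - (?q + 1))\<^sup>2)
      = (\<Sum>c\<in>UNIV. (n c)\<^sup>2) - 2 * (?q + 1) * (\<Sum>c\<in>UNIV. n c) + ?q * (?q + 1)\<^sup>2"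
    by (simp add: sum.distrib sum_subtractf flip: sum_distrib_left)
  also have "\<dots> = ?q\<^sup>2" unfolding sq sm by (simp add: algebra_simps power2_eq_square)
  also have "(\<Sum>c\<in>UNIV. (n c - (?q + 1))\<^sup>2) = ?q\<^sup>2 + (\<Sum>c\<in>UNIV-{0}. (n c - (?q + 1))\<^sup>2)"
    by (subst sum.remove[of _ 0]) (simp_all add: n0)
  finally have "(\<Sum>c\<in>UNIV-{0}. (n c - (?q + 1))\<^sup>2) = 0" by simp
  then have "n c = ?q + 1" using c by (subst (asm) sum_nonneg_eq_0_iff) auto
  then have "{s. hermitian \<gamma> (*) s = c} \<noteq> {}" unfolding n_def by (metis card.empty of_nat_0 of_nat_0_le_iff add_nonneg_eq_0_iff zero_neq_one zero_le_one)
  then show ?thesis using that by blast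
qed

context finite_space
begin

lemma hermitian_ext_scale:
  assumes f: "f \<in> symm_forms scale"
  shows "hermitian \<gamma> f (ext_scale \<gamma> scale s z) = hermitian \<gamma> (*) s * hermitian \<gamma> f z"
  using symm_formsD(5)[OF f, of "snd z" "fst z"]
  by (cases s; cases z) (simp add: hermitian_def ext_scale_def symm_formsD(1-4)[OF f] algebra_simps)

lemma ext_scale_assoc:
  "ext_scale \<gamma> scale s (ext_scale \<gamma> scale t z) = ext_scale \<gamma> scale (ext_scale \<gamma> (*) s t) z"
  by (cases s; cases t; cases z) (simp add: ext_scale_def algebra_simps)

lemma ext_scale_zero [simp]: "ext_scale \<gamma> scale 0 z = 0" "ext_scale \<gamma> scale s 0 = 0"
  by (cases z; cases s; simp add: ext_scale_def zero_prod_def)+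

lemma ext_scale_diff:
  "ext_scale \<gamma> scale (s - t) z = ext_scale \<gamma> scale s z - ext_scale \<gamma> scale t z"
  "ext_scale \<gamma> scale s (w - z) = ext_scale \<gamma> scale s w - ext_scale \<gamma> scale s z"
  by (cases s; cases t; cases w; cases z; simp add: ext_scale_def algebra_simps)+

text \<open>
  Multiplication by the conjugate \<open>(a + b) - b \<omega>\<close> of \<open>a + b \<omega>\<close> turns \<open>ext_scale \<gamma> scale (a, b)\<close> into the
  scaling by the norm.
\<close>

lemma ext_scale_eq_0_imp:
  assumes \<gamma>: "\<And>x. x * x + x \<noteq> \<gamma>" and "ext_scale \<gamma> scale s z = 0" "s \<noteq> 0"
  shows "z = 0"
proof -
  obtain a b where s: "s = (a, b)" by (cases s)
  obtain x y where z: "z = (x, y)" by (cases z)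
  let ?N = "hermitian \<gamma> (*) s"
  have "ext_scale \<gamma> scale (a + b, - b) (ext_scale \<gamma> scale s z) = (scale ?N x, scale ?N y)"
    by (simp add: s z ext_scale_def hermitian_def algebra_simps)
  then have "scale ?N x = 0" "scale ?N y = 0" using assms(2) by (simp_all add: zero_prod_def[symmetric] prod_eq_iff)
  moreover have "?N \<noteq> 0" using norm_eq_0_imp[OF \<gamma>] assms(3) by blast
  ultimately show ?thesis by (simp add: z zero_prod_def)
qed

text \<open>
  Multiplication by an element of norm \<open>d / c\<close> maps the fibre over \<open>c\<close> injectively into that over \<open>d\<close>.
\<close>

lemma card_hermitian_fibre_cong:
  assumes f: "f \<in> symm_forms scale" and \<gamma>: "\<And>x. x * x + x \<noteq> \<gamma>" and "c \<noteq> 0" "d \<noteq> 0"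
  shows "card {z. hermitian \<gamma> f z = c} = card {z. hermitian \<gamma> f z = d}"
proof -
  have le: "card {z. hermitian \<gamma> f z = c} \<le> card {z. hermitian \<gamma> f z = d}" if nz: "c \<noteq> 0" "d \<noteq> 0" for c d
  proof -
    obtain s where s: "hermitian \<gamma> (*) s = d / c" using norm_surjective[OF \<gamma>, of "d / c"] nz by auto
    then have s0: "s \<noteq> 0" using nz by (auto simp: hermitian_def zero_prod_def)
    show ?thesis
    proof (rule card_inj_on_le)
      show "inj_on (ext_scale \<gamma> scale s) {z. hermitian \<gamma> f z = c}"
        using ext_scale_eq_0_imp[OF \<gamma> _ s0] by (intro inj_onI) (metis ext_scale_diff(2) eq_iff_diff_eq_0)
      show "ext_scale \<gamma> scale s ` {z. hermitian \<gamma> f z = c} \<subseteq> {z. hermitian \<gamma> f z = d}"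
        using s nz by (auto simp: hermitian_ext_scale[OF f])
      show "finite {z. hermitian \<gamma> f z = d}" by (rule finite_subset[OF subset_UNIV]) (simp add: finite_prod)
    qed
  qed
  show ?thesis using le[of c d] le[of d c] assms by simp
qed

text \<open>
  The zeros other than \<open>0\<close> are permuted freely by the nonzero elements of the quadratic extension.
\<close>

lemma ext_units_dvd_card_hermitian_zeros:
  assumes f: "f \<in> symm_forms scale" and \<gamma>: "\<And>x. x * x + x \<noteq> \<gamma>"
  shows "(CARD('k)\<^sup>2 - 1) dvd card ({z. hermitian \<gamma> f z = 0} - {0})"
proof (rule dvd_card_of_orbit_sizes[where orb = "\<lambda>z. (\<lambda>s. ext_scale \<gamma> scale s z) ` (- {0})"])
  let ?S = "{z. hermitian \<gamma> f z = 0} - {0}" and ?orb = "\<lambda>z. (\<lambda>s. ext_scale \<gamma> scale s z) ` (- {0})"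
  show fin: "finite ?S" by (rule finite_subset[OF subset_UNIV]) (simp add: finite_prod)
  show "z \<in> ?orb z" for z
  proof -
    have "z = ext_scale \<gamma> scale (1, 0) z" by (cases z) (simp add: ext_scale_def)
    then show ?thesis by (auto simp: zero_prod_def image_iff)
  qed
  show sub: "?orb z \<subseteq> ?S" if "z \<in> ?S" for z
    using that ext_scale_eq_0_imp[OF \<gamma>, of _ z] by (auto simp: hermitian_ext_scale[OF f])
  show size: "card (?orb z) = CARD('k)\<^sup>2 - 1" if "z \<in> ?S" for z
  proof -
    have "inj_on (\<lambda>s. ext_scale \<gamma> scale s z) (- {0})"
      using ext_scale_eq_0_imp[OF \<gamma>, of _ z] that
      by (intro inj_onI) (metis DiffD2 ext_scale_diff(1) eq_iff_diff_eq_0 singleton_iff)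
    then have "card (?orb z) = card (- {0 :: 'k \<times> 'k})" by (rule card_image)
    also have "\<dots> = CARD('k)\<^sup>2 - 1" by (simp add: Compl_eq_Diff_UNIV card_Diff_subset power2_eq_square)
    finally show ?thesis .
  qed
  show "?orb y = ?orb z" if z: "z \<in> ?S" and y: "y \<in> ?orb z" for y z
  proof (rule card_subset_eq)
    obtain s where s: "s \<noteq> 0" "y = ext_scale \<gamma> scale s z" using y by auto
    have "ext_scale \<gamma> (*) t s \<noteq> 0" if "t \<noteq> 0" for t
      using finite_space.ext_scale_eq_0_imp[OF finite_space_field \<gamma>] s(1) that by blast
    then show "?orb y \<subseteq> ?orb z" by (auto simp: s(2) ext_scale_assoc)
    have "y \<in> ?S" using sub[OF z] y by blast
    then show "card (?orb y) = card (?orb z)" by (simp only: size z)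
    show "finite (?orb z)" by (rule finite_subset[OF sub[OF z] fin])
  qed
qed

text \<open>
  Let \<open>n0\<close> and \<open>n1\<close> be the sizes of the fibres over \<open>0\<close> and over any nonzero value. The known sums of
  the fibre sizes and of their squares determine \<open>n0 - n1\<close> up to a sign. The sign is found modulo
  \<open>q + 1\<close>: there \<open>n0 - n1\<close> is \<open>1\<close>, as the number of nonzero zeros is divisible by \<open>q\<^sup>2 - 1\<close>, while
  \<open>q ^ (2 * n - r)\<close> is \<open>(- 1) ^ r\<close>.
\<close>

lemma card_hermitian_zeros:
  assumes f: "f \<in> symm_forms scale" and \<gamma>: "\<And>x. x * x + x \<noteq> \<gamma>"
  defines "n \<equiv> dim (UNIV :: 'v set)" and "r \<equiv> form_rank scale f" and "q \<equiv> int CARD('k)"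
  shows "q * int (card {z. hermitian \<gamma> f z = 0}) = q ^ (2 * n) + (q - 1) * ((- 1) ^ r * q ^ (2 * n - r))"
proof -
  have q1: "q > 1" using field_card_gt_1[where 'k = 'k] by (simp add: q_def)
  have rn: "r \<le> n" using card_radical(1)[OF f] by (simp add: r_def n_def)
  define Q R where "Q = q ^ n" and "R = q ^ (n - r)"
  have Q: "int (card (UNIV :: 'v set)) = Q" and R: "int (card (form_radical f)) = R"
    using card_radical(2,3)[OF f] by (simp_all add: Q_def R_def q_def n_def r_def)
  have QR: "Q * R = q ^ (2 * n - r)" using rn by (simp add: Q_def R_def mult_2 flip: power_add)
  define n0 n1 where "n0 = int (card {z. hermitian \<gamma> f z = 0})" and "n1 = int (card {z. hermitian \<gamma> f z = 1})"
  have const: "int (card {z. hermitian \<gamma> f z = c}) = (if c = 0 then n0 else n1)" for c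
    using card_hermitian_fibre_cong[OF f \<gamma>, of c 1] by (simp add: n0_def n1_def)
  have sum_if: "(\<Sum>c\<in>(UNIV::'k set). if c = 0 then a else b) = a + (q - 1) * b" for a b :: int
    by (subst sum.remove[of _ 0]) (simp_all add: q_def card_Diff_singleton of_nat_diff)
  have "int (card (UNIV :: ('v \<times> 'v) set)) = (\<Sum>c\<in>UNIV. int (card {z. hermitian \<gamma> f z = c}))"
    using sum.group[of "UNIV :: ('v \<times> 'v) set" "UNIV :: 'k set" "hermitian \<gamma> f" "\<lambda>_. 1::int"]
    by (simp add: finite_prod)
  then have S1: "Q\<^sup>2 = n0 + (q - 1) * n1"
    by (simp add: const sum_if power2_eq_square flip: Q)
  have "(\<Sum>c\<in>UNIV. (int (card {z. hermitian \<gamma> f z = c}))\<^sup>2) = n0\<^sup>2 + (q - 1) * n1\<^sup>2"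
    unfolding sum_if[symmetric] const by (rule sum.cong) auto
  then have S2: "q * (n0\<^sup>2 + (q - 1) * n1\<^sup>2) = Q\<^sup>2 * (q * R\<^sup>2 + Q\<^sup>2 - R\<^sup>2)"
    using sum_squares_hermitian[OF f \<gamma>] by (simp add: Q R q_def)
  have "(q - 1) * (n0 - n1)\<^sup>2 = q * (n0\<^sup>2 + (q - 1) * n1\<^sup>2) - (n0 + (q - 1) * n1)\<^sup>2"
    by (simp add: algebra_simps power2_eq_square)
  also have "\<dots> = (q - 1) * (Q * R)\<^sup>2"
    unfolding S2 S1[symmetric] by (simp add: algebra_simps power2_eq_square)
  finally have "(n0 - n1)\<^sup>2 = (Q * R)\<^sup>2" using q1 by simp
  then obtain \<epsilon> :: int where \<epsilon>: "\<epsilon> = 1 \<or> \<epsilon> = -1" "n0 - n1 = \<epsilon> * (Q * R)"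
    by (metis power2_eq_iff mult_1 mult_minus1)
  have G: "(q - 1) * (n0 - n1) = q * n0 - Q\<^sup>2" using S1 by (simp add: algebra_simps)
  obtain k where k: "n0 = 1 + (q\<^sup>2 - 1) * k"
  proof -
    have "finite {z. hermitian \<gamma> f z = 0}" by (rule finite_subset[OF subset_UNIV]) (simp add: finite_prod)
    then have "n0 = int (card ({z. hermitian \<gamma> f z = 0} - {0})) + 1"
      unfolding n0_def
      by (subst card.remove[of _ 0]) (auto simp: hermitian_def zero_prod_def symm_formsD[OF f])
    moreover have "int (CARD('k)\<^sup>2 - 1) dvd int (card ({z. hermitian \<gamma> f z = 0} - {0}))"
      using ext_units_dvd_card_hermitian_zeros[OF f \<gamma>] by (simp only: of_nat_dvd_iff)
    moreover have "int (CARD('k)\<^sup>2 - 1) = q\<^sup>2 - 1" by (simp add: q_def of_nat_diff)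
    ultimately show ?thesis using that by (auto simp: dvd_def)
  qed
  have "q\<^sup>2 - 1 dvd (q\<^sup>2) ^ n - 1 ^ n" by (simp only: power_diff_sumr2 dvd_triv_left)
  then obtain j where j: "Q\<^sup>2 = 1 + (q\<^sup>2 - 1) * j"
    by (auto simp: Q_def dvd_def simp flip: power_mult) (metis diff_eq_eq mult.commute add.commute)
  have "q * (1 + (q\<^sup>2 - 1) * k) - (1 + (q\<^sup>2 - 1) * j) = (q - 1) * (1 + (q + 1) * (q * k - j))"
    by (simp add: algebra_simps power2_eq_square)
  then have "(q - 1) * (n0 - n1) = (q - 1) * (1 + (q + 1) * (q * k - j))"
    unfolding G j by (simp only: k)
  then have "n0 - n1 = 1 + (q + 1) * (q * k - j)" using q1 by simp
  then have "q + 1 dvd \<epsilon> * (Q * R) - 1" using \<epsilon>(2) by simp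
  moreover have "q + 1 dvd Q * R - (- 1) ^ r"
  proof -
    have "q - (- 1) dvd q ^ (2 * n - r) - (- 1) ^ (2 * n - r)" by (simp only: power_diff_sumr2 dvd_triv_left)
    moreover have "(- 1 :: int) ^ (2 * n - r) = (- 1) ^ r"
      using rn by (simp add: minus_one_power_iff)
    ultimately show ?thesis by (simp add: QR)
  qed
  then have "q + 1 dvd \<epsilon> * (Q * R) - \<epsilon> * (- 1) ^ r" by (metis dvd_mult right_diff_distrib)
  ultimately have "q + 1 dvd (\<epsilon> * (Q * R) - 1) - (\<epsilon> * (Q * R) - \<epsilon> * (- 1) ^ r)"
    by (rule dvd_diff)
  then have "q + 1 dvd \<epsilon> * (- 1) ^ r - 1" by simp
  moreover have "\<epsilon> * (- 1) ^ r = 1 \<or> \<epsilon> * (- 1) ^ r = -1" using \<epsilon>(1) by (auto simp: minus_one_power_iff)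
  ultimately have "\<epsilon> * (- 1) ^ r = 1" using q1 zdvd_imp_le[of "q + 1" 2] by auto
  then have "\<epsilon> = (- 1) ^ r" using \<epsilon>(1) by (auto simp: minus_one_power_iff split: if_splits)
  then show ?thesis using G \<epsilon>(2) unfolding QR[symmetric] n0_def[symmetric]
    by (simp add: Q_def algebra_simps flip: power_mult)
qed

end

section \<open>Common zeros of a space of forms\<close>

context finite_space
begin

lemma finite_space_forms: "finite_space (form_scale :: 'k \<Rightarrow> ('v \<Rightarrow> 'v \<Rightarrow> 'k) \<Rightarrow> _)"
proof -
  have "finite (UNIV :: ('v \<Rightarrow> 'v \<Rightarrow> 'k) set)" by (simp add: finite_UNIV_fun)
  then show ?thesis
    by (simp add: finite_space_def finite_space_axioms_def forms.vector_space_axioms)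
qed

lemma card_forms_subspace:
  fixes N :: "('v \<Rightarrow> 'v \<Rightarrow> 'k) set"
  assumes "forms.subspace N"
  shows "card N = CARD('k) ^ forms.dim N"
  using finite_space.card_subspace[OF finite_space_forms assms] .

text \<open>
  Count pairs \<open>(f, z)\<close> with \<open>E f z = 0\<close> in two ways. For fixed \<open>z\<close>, the functional \<open>f \<mapsto> E f z\<close> on \<open>N\<close>
  either vanishes identically, or does so on exactly one \<open>q\<close>-th of \<open>N\<close>.
\<close>

lemma card_common_zeros:
  fixes N :: "('v \<Rightarrow> 'v \<Rightarrow> 'k) set" and E :: "('v \<Rightarrow> 'v \<Rightarrow> 'k) \<Rightarrow> 'w \<Rightarrow> 'k"
  assumes N: "forms.subspace N" and fin: "finite (UNIV :: 'w set)"
    and add: "\<And>f g z. E (f + g) z = E f z + E g z"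
    and scale: "\<And>c f z. E (form_scale c f) z = c * E f z"
    and zeros: "\<And>f. f \<in> N \<Longrightarrow> int CARD('k) * int (card {z. E f z = 0}) =
      int (card (UNIV :: 'w set)) + (int CARD('k) - 1) * wt f"
  shows "int (card N) * int (card {z. \<forall>f\<in>N. E f z = 0}) = (\<Sum>f\<in>N. wt f)"
proof -
  let ?q = "int CARD('k)" and ?Z = "{z. \<forall>f\<in>N. E f z = 0}" and ?W = "int (card (UNIV :: 'w set))"
  have finN: "finite N" using finite_space.finite_vectors[OF finite_space_forms] .
  have fibre: "?q * int (card {f\<in>N. E f z = 0}) = int (card N) + (if z \<in> ?Z then (?q - 1) * int (card N) else 0)" for z
  proof (cases "z \<in> ?Z")
    case True
    then have "{f\<in>N. E f z = 0} = N" by auto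
    then show ?thesis using True by (simp add: algebra_simps)
  next
    case False
    then obtain g where g: "g \<in> N" "E g z \<noteq> 0" by auto
    have "\<exists>f\<in>N. E f z = c" for c
      using g forms.subspace_scale[OF N]
      by (intro bexI[of _ "form_scale (c / E g z) g"]) (simp_all add: scale)
    then have "CARD('k) * card {f\<in>N. E f z = 0} = card N"
      by (intro card_additive_fibre[where g = "\<lambda>f. E f z"])
        (simp_all add: add finN forms.subspace_add[OF N] forms.subspace_diff[OF N])
    then have "?q * int (card {f\<in>N. E f z = 0}) = int (card N)" by (simp flip: of_nat_mult)
    then show ?thesis by (simp only: if_not_P[OF False] add_0_right)
  qed
  have count: "int (card {z. E f z = 0}) = (\<Sum>z\<in>UNIV. of_bool (E f z = 0))" for f
    using fin by simp
  have count': "int (card {f\<in>N. E f z = 0}) = (\<Sum>f\<in>N. of_bool (E f z = 0))" for z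
    using finN by (simp add: Int_def)
  have "int (card N) * ?W + (?q - 1) * (\<Sum>f\<in>N. wt f) = (\<Sum>f\<in>N. ?W + (?q - 1) * wt f)"
    by (simp add: sum.distrib sum_distrib_left)
  also have "\<dots> = (\<Sum>f\<in>N. ?q * int (card {z. E f z = 0}))"
    by (rule sum.cong) (simp_all add: zeros)
  also have "\<dots> = ?q * (\<Sum>f\<in>N. \<Sum>z\<in>UNIV. of_bool (E f z = 0))"
    by (simp only: count sum_distrib_left)
  also have "\<dots> = ?q * (\<Sum>z\<in>UNIV. \<Sum>f\<in>N. of_bool (E f z = 0))"
    by (subst sum.swap) (rule refl)
  also have "\<dots> = (\<Sum>z\<in>UNIV. ?q * int (card {f\<in>N. E f z = 0}))"
    by (simp only: count' sum_distrib_left)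
  also have "\<dots> = (\<Sum>z\<in>UNIV. int (card N) + (if z \<in> ?Z then (?q - 1) * int (card N) else 0))"
    by (simp only: fibre)
  also have "\<dots> = ?W * int (card N) + int (card ?Z) * ((?q - 1) * int (card N))"
    by (simp only: sum.distrib sum_constant sum.If_cases[OF fin] sum.neutral_const
        Collect_mem_eq Int_UNIV_left add_0_right of_nat_mult)
  finally have eq: "(?q - 1) * (\<Sum>f\<in>N. wt f) = (?q - 1) * (int (card N) * int (card ?Z))"
    by (simp add: algebra_simps)
  have "?q - 1 \<noteq> 0" using field_card_gt_1[where 'k = 'k] by simp
  from mult_left_cancel[OF this] eq show ?thesis by simp
qed

lemma square_dvd_card_translation_invariant:
  assumes u: "u \<noteq> 0"
    and S: "\<And>x y a b. (x, y) \<in> S \<Longrightarrow> (x + scale a u, y + scale b u) \<in> S"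
  shows "CARD('k)\<^sup>2 dvd card S"
proof (rule dvd_card_of_orbit_sizes)
  let ?orb = "\<lambda>z. range (\<lambda>(a, b). (fst z + scale a u, snd z + scale b u))"
  show "finite S" by (rule finite_subset[OF subset_UNIV]) (simp add: finite_prod)
  show "z \<in> ?orb z" for z
    by (rule range_eqI[of _ _ "(0, 0)"]) simp
  show "?orb z \<subseteq> S" if "z \<in> S" for z
    using that S by (cases z) auto
  have inj: "inj (\<lambda>(a, b). (fst z + scale a u, snd z + scale b u))" for z
    using u by (auto simp: inj_def)
  have size: "card (?orb z) = CARD('k)\<^sup>2" for z
    by (subst card_image[OF inj]) (simp add: power2_eq_square)
  then show "card (?orb z) = CARD('k)\<^sup>2" for z .
  show "?orb y = ?orb z" if "y \<in> ?orb z" for y z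
  proof (rule card_subset_eq)
    from that obtain a b where y: "y = (fst z + scale a u, snd z + scale b u)" by auto
    show "?orb y \<subseteq> ?orb z"
    proof
      fix w assume "w \<in> ?orb y"
      then obtain c d where "w = (fst y + scale c u, snd y + scale d u)" by auto
      then show "w \<in> ?orb z"
        by (intro range_eqI[of _ _ "(a + c, b + d)"]) (simp add: y scale_left_distrib add.assoc)
    qed
    show "card (?orb y) = card (?orb z)" by (simp only: size)
  qed simp
qed

end

section \<open>The dimension bounds\<close>

text \<open>
  The arithmetic that separates the two ranks. In the application \<open>A\<close> and \<open>B\<close> are the numbers of
  forms of rank \<open>r\<close> and \<open>l\<close>, and \<open>Z\<close> and \<open>T\<close> the numbers of common zeros of the forms and of their
  Hermitian extensions.
\<close>

lemma dvd_two_of_rank_counts: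
  fixes q A B Z T :: int and d n r l :: nat
  assumes rl: "0 < r" "r < l" "l < n" and parity: "odd r \<longleftrightarrow> even l"
    and q: "q > 1" and total: "q ^ d = 1 + A + B" and d: "2 * n - 1 - r \<le> d"
    and Z: "q ^ d * Z = q ^ (2 * n) + A * q ^ (2 * n - r) + B * q ^ (2 * n - l)" "q\<^sup>2 dvd Z"
    and T: "q ^ d * T = q ^ (2 * n) + A * ((- 1) ^ r * q ^ (2 * n - r))
      + B * ((- 1) ^ l * q ^ (2 * n - l))" "q\<^sup>2 dvd T"
  shows "q dvd 2"
proof -
  define E where "E = 2 * n + 1 - r"
  \<comment> \<open>the sign of the rank-\<open>r\<close> terms in \<open>T\<close>; parity makes that of the rank-\<open>l\<close> terms opposite\<close>
  define s :: int where "s = (- 1) ^ r"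
  have s: "s * s = 1" "(- 1) ^ l = - s" using parity by (auto simp: s_def minus_one_power_iff)
  have EZ: "q ^ E dvd q ^ d * X" if "q\<^sup>2 dvd X" for X
  proof -
    have "q ^ E dvd q ^ (d + 2)" using d rl by (intro le_imp_power_dvd) (simp add: E_def)
    also have "q ^ (d + 2) dvd q ^ d * X" using that unfolding power_add by (intro mult_dvd_mono dvd_refl)
    finally show ?thesis .
  qed
  \<comment> \<open>the term of the zero form is harmless because \<open>r\<close> is positive\<close>
  have En: "q ^ E dvd q ^ (2 * n)" using rl by (intro le_imp_power_dvd) (simp add: E_def)
  have p: "q ^ E dvd A * q ^ (2 * n - r) + B * q ^ (2 * n - l)"
    using EZ[OF Z(2)] En unfolding Z(1) by (metis add.assoc dvd_add_right_iff)
  have "q ^ E dvd A * (s * q ^ (2 * n - r)) + B * (- s * q ^ (2 * n - l))"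
    using EZ[OF T(2)] En unfolding T(1) s(2) s_def[symmetric] by (metis add.assoc dvd_add_right_iff)
  then have "q ^ E dvd s * (A * (s * q ^ (2 * n - r)) + B * (- s * q ^ (2 * n - l)))" by simp
  also have "\<dots> = (s * s) * (A * q ^ (2 * n - r) - B * q ^ (2 * n - l))" by (simp add: algebra_simps)
  finally have m: "q ^ E dvd A * q ^ (2 * n - r) - B * q ^ (2 * n - l)" by (simp add: s)
  have cancel: "q dvd 2 * X" if "q ^ E dvd 2 * (X * q ^ k)" "k < E" for X k
  proof -
    have "q ^ E = q ^ (E - k) * q ^ k" using that(2) by (simp flip: power_add)
    then have "q ^ (E - k) * q ^ k dvd (2 * X) * q ^ k" using that(1) by (simp only: mult.assoc)
    then have "q ^ (E - k) dvd 2 * X" using q by simp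
    moreover have "q dvd q ^ (E - k)" using that(2) by (simp add: dvd_power)
    ultimately show ?thesis by (rule dvd_trans[rotated])
  qed
  have "q dvd 2 * A"
    using dvd_add[OF p m] rl by (intro cancel[where k = "2 * n - r"]) (simp_all add: E_def)
  moreover have "q dvd 2 * B"
    using dvd_diff[OF p m] rl by (intro cancel[where k = "2 * n - l"]) (simp_all add: E_def)
  moreover have "d > 0" using d rl by linarith
  then have "q dvd 2 * q ^ d" by (intro dvd_mult dvd_power) simp
  ultimately have "q dvd 2 * q ^ d - (2 * A + 2 * B)" by (intro dvd_diff dvd_add)
  then show ?thesis by (simp add: total)
qed

context finite_space
begin

lemma dim_two_ranks_common_radical_le:
  fixes N :: "('v \<Rightarrow> 'v \<Rightarrow> 'k) set"
  defines "n \<equiv> dim (UNIV :: 'v set)"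
  assumes N: "forms.subspace N" and symm: "N \<subseteq> symm_forms scale"
    and u: "u \<noteq> 0" and rad: "\<And>f. f \<in> N \<Longrightarrow> u \<in> form_radical f"
    and ranks: "\<And>f. f \<in> N \<Longrightarrow> f \<noteq> 0 \<Longrightarrow> form_rank scale f \<in> {r, l}"
    and rl: "0 < r" "r < l" "l < n" and parity: "odd r \<longleftrightarrow> even l" and q2: "CARD('k) \<noteq> 2"
  shows "int (forms.dim N) \<le> 2 * int n - 2 - int r"
proof (rule ccontr)
  assume "\<not> ?thesis"
  then have d: "2 * n - 1 - r \<le> forms.dim N" by linarith
  let ?q = "int CARD('k)"
  have q1: "?q > 1" using field_card_gt_1[where 'k = 'k] by simp
  have finN: "finite N" using finite_space.finite_vectors[OF finite_space_forms] .
  have cardN: "int (card N) = ?q ^ forms.dim N" by (simp add: card_forms_subspace[OF N])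
  have V: "int (card (UNIV :: ('v \<times> 'v) set)) = ?q ^ (2 * n)"
    using card_subspace[OF subspace_UNIV] by (simp add: n_def mult_2 power_add)
  obtain \<gamma> :: 'k where \<gamma>: "\<And>x. x * x + x \<noteq> \<gamma>" using artin_schreier_not_surjective by blast
  define Nr Nl where "Nr = {f \<in> N - {0}. form_rank scale f = r}" and "Nl = {f \<in> N - {0}. form_rank scale f = l}"
  have zero: "0 \<in> N" using forms.subspace_0[OF N] .
  have rank0: "form_rank scale (0 :: 'v \<Rightarrow> 'v \<Rightarrow> 'k) = 0"
    by (simp add: form_rank_def form_radical_def)
  have sum_N: "(\<Sum>f\<in>N. w (form_rank scale f)) = w 0 + int (card Nr) * w r + int (card Nl) * w l"
    for w :: "nat \<Rightarrow> int"
  proof -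
    have "N - {0} = Nr \<union> Nl" using ranks by (auto simp: Nr_def Nl_def)
    then have "(\<Sum>f\<in>N - {0}. w (form_rank scale f))
        = (\<Sum>f\<in>Nr. w (form_rank scale f)) + (\<Sum>f\<in>Nl. w (form_rank scale f))"
      using rl finN by (simp only:) (rule sum.union_disjoint; auto simp: Nr_def Nl_def)
    also have "\<dots> = (\<Sum>f\<in>Nr. w r) + (\<Sum>f\<in>Nl. w l)"
      by (intro arg_cong2[where f = "(+)"] sum.cong) (simp_all add: Nr_def Nl_def)
    finally show ?thesis by (simp add: sum.remove[OF finN zero] rank0)
  qed
  have total: "?q ^ forms.dim N = 1 + int (card Nr) + int (card Nl)"
    using sum_N[of "\<lambda>_. 1"] by (simp add: cardN)
  let ?Z = "{z. \<forall>f\<in>N. (case z of (x, y) \<Rightarrow> f x y) = 0}" and ?T = "{z. \<forall>f\<in>N. hermitian \<gamma> f z = 0}"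
  have fin2: "finite (UNIV :: ('v \<times> 'v) set)" by (simp add: finite_prod)
  have Z: "?q ^ forms.dim N * int (card ?Z) = ?q ^ (2 * n) + int (card Nr) * ?q ^ (2 * n - r)
      + int (card Nl) * ?q ^ (2 * n - l)"
  proof -
    have "int (card N) * int (card ?Z) = (\<Sum>f\<in>N. ?q ^ (2 * n - form_rank scale f))"
    proof (rule card_common_zeros[OF N fin2, where E = "\<lambda>f (x, y). f x y"])
      show "?q * int (card {z. (case z of (x, y) \<Rightarrow> f x y) = 0})
          = int (card (UNIV :: ('v \<times> 'v) set)) + (?q - 1) * ?q ^ (2 * n - form_rank scale f)"
        if "f \<in> N" for f
        unfolding V using card_form_zeros[of f] symm that
        by (simp add: n_def case_prod_unfold subset_iff)
    qed (auto simp: form_scale_def)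
    then show ?thesis using sum_N[of "\<lambda>k. ?q ^ (2 * n - k)"] by (simp add: cardN)
  qed
  have T: "?q ^ forms.dim N * int (card ?T) = ?q ^ (2 * n) + int (card Nr) * ((- 1) ^ r * ?q ^ (2 * n - r))
      + int (card Nl) * ((- 1) ^ l * ?q ^ (2 * n - l))"
  proof -
    have "int (card N) * int (card ?T)
        = (\<Sum>f\<in>N. (- 1) ^ form_rank scale f * ?q ^ (2 * n - form_rank scale f))"
    proof (rule card_common_zeros[OF N fin2])
      show "?q * int (card {z. hermitian \<gamma> f z = 0}) = int (card (UNIV :: ('v \<times> 'v) set))
          + (?q - 1) * ((- 1) ^ form_rank scale f * ?q ^ (2 * n - form_rank scale f))"
        if "f \<in> N" for f
        unfolding V using card_hermitian_zeros[of f \<gamma>] \<gamma> symm that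
        by (simp add: n_def subset_iff)
    qed (auto simp: form_scale_def hermitian_def algebra_simps)
    then show ?thesis using sum_N[of "\<lambda>k. (- 1) ^ k * ?q ^ (2 * n - k)"] by (simp add: cardN)
  qed
  have shift: "f (x + scale a u) (y + scale b u) = f x y" if "f \<in> N" for f x y a b
  proof -
    have f: "f \<in> symm_forms scale" using symm that by blast
    have "f u v = 0" "f v u = 0" for v
      using rad[OF that] symm_formsD(5)[OF f, of v u] by (auto simp: form_radical_def)
    then show ?thesis by (simp add: symm_formsD(1-4)[OF f])
  qed
  have "CARD('k)\<^sup>2 dvd card ?Z" "CARD('k)\<^sup>2 dvd card ?T"
    by (rule square_dvd_card_translation_invariant[OF u]; simp add: shift hermitian_def)+
  then have "?q\<^sup>2 dvd int (card ?Z)" "?q\<^sup>2 dvd int (card ?T)"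
    by (simp_all only: of_nat_dvd_iff flip: of_nat_power)
  from dvd_two_of_rank_counts[OF rl parity q1 total d Z this(1) T this(2)]
  have "?q \<le> 2" by (rule zdvd_imp_le) simp
  with q1 q2 show False by simp
qed

lemma subspace_forms_radical_at:
  fixes M :: "('v \<Rightarrow> 'v \<Rightarrow> 'k) set"
  assumes "forms.subspace M"
  shows "forms.subspace (forms_radical_at M u)"
  using assms by (auto simp: forms.subspace_def forms_radical_at_def form_radical_def form_scale_def)

text \<open>
  Restricted to a basis of \<open>V\<close>, the functionals \<open>f u\<close> take at most \<open>q ^ n\<close> values, and two forms with the
  same \<open>f u\<close> differ by an element of \<open>M\<^sub>u\<close>.
\<close>

lemma dim_le_dim_radical_at:
  fixes M :: "('v \<Rightarrow> 'v \<Rightarrow> 'k) set"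
  assumes M: "forms.subspace M" and symm: "M \<subseteq> symm_forms scale"
  shows "forms.dim M \<le> dim (UNIV :: 'v set) + forms.dim (forms_radical_at M u)"
proof -
  let ?Mu = "forms_radical_at M u"
  have finM: "finite A" for A :: "('v \<Rightarrow> 'v \<Rightarrow> 'k) set"
    using finite_space.finite_vectors[OF finite_space_forms] .
  obtain C where C: "UNIV \<subseteq> span C" "card C = dim (UNIV :: 'v set)"
    using basis_exists[of UNIV] by blast
  let ?P = "C \<rightarrow>\<^sub>E (UNIV :: 'k set)"
  let ?g = "\<lambda>f :: 'v \<Rightarrow> 'v \<Rightarrow> 'k. restrict (f u) C"
  have fibre: "card {f \<in> M. ?g f = p} \<le> card ?Mu" for p
  proof (cases "{f \<in> M. ?g f = p} = {}")
    case False
    then obtain h where h: "h \<in> M" "?g h = p" by blast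
    show ?thesis
    proof (rule card_inj_on_le[where f = "\<lambda>f. f - h"])
      show "(\<lambda>f. f - h) ` {f \<in> M. ?g f = p} \<subseteq> ?Mu"
      proof (rule image_subsetI)
        fix f assume "f \<in> {f \<in> M. ?g f = p}"
        then have f: "f \<in> M" and eq: "?g f = ?g h" using h by auto
        have fh: "f - h \<in> M" using forms.subspace_diff[OF M f h(1)] .
        then have s: "f - h \<in> symm_forms scale" using symm by blast
        have on_C: "(f - h) u v = 0" if "v \<in> C" for v
          using fun_cong[OF eq, of v] that by simp
        have "(f - h) u v = 0" for v
        proof (rule span_induct[where P = "\<lambda>v. (f - h) u v = 0" and S = C])
          show "v \<in> span C" using C(1) by blast
          show "subspace {v. (f - h) u v = 0}"
            by (rule subspaceI) (simp_all only: mem_Collect_eq symm_formsD[OF s] add_0_right mult_zero_right)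
        qed (use on_C in simp)
        then show "f - h \<in> ?Mu" using fh by (simp add: forms_radical_at_def form_radical_def)
      qed
    qed (simp_all add: finM inj_on_def)
  next
    case True
    then show ?thesis by (simp only: card.empty le0)
  qed
  have "card M = (\<Sum>p\<in>?P. card {f \<in> M. ?g f = p})"
    using sum.group[of M ?P ?g "\<lambda>_. 1::nat"] finM by (simp add: finite_PiE image_subset_iff)
  also have "\<dots> \<le> (\<Sum>p\<in>?P. card ?Mu)" by (rule sum_mono) (rule fibre)
  also have "\<dots> = CARD('k) ^ (dim (UNIV :: 'v set)) * card ?Mu" by (simp add: card_PiE C(2))
  finally have "CARD('k) ^ forms.dim M \<le> CARD('k) ^ (dim (UNIV :: 'v set) + forms.dim ?Mu)"
    by (simp add: card_forms_subspace M subspace_forms_radical_at power_add)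
  then show ?thesis using power_le_imp_le_exp[OF field_card_gt_1] by blast
qed

end

theorem theorem17:
  fixes scale :: "'k::{field,finite} \<Rightarrow> 'v::ab_group_add \<Rightarrow> 'v"
    and B :: "'v set"
    and M :: "('v \<Rightarrow> 'v \<Rightarrow> 'k) set"
    and q n r l :: nat
  assumes q: "card (UNIV :: 'k set) = q" and q_neq_2: "q \<noteq> 2"
    and V: "finite_dimensional_vector_space scale B"
    and dim_V: "vector_space.dim scale (UNIV :: 'v set) = n"
    and M_subspace: "forms.subspace M" and M_symm: "M \<subseteq> symm_forms scale"
    and ranks: "\<And>f. f \<in> M \<Longrightarrow> f \<noteq> 0 \<Longrightarrow> form_rank scale f \<in> {r, l, n}"
    and r_pos: "0 < r" and l_pos: "0 < l"
    and parity: "odd r \<longleftrightarrow> even l"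
    and r_less_l: "r < l" and l_less_n: "l < n"
  shows "int (forms.dim M) \<le> 3 * int n - int r - 2 \<and>
         (\<forall>u. u \<noteq> 0 \<longrightarrow>
            int (forms.dim (forms_radical_at M u)) \<le> 2 * int n - 2 - int r)"
proof -
  interpret finite_space scale by (rule finite_space_of_finite_dimensional[OF V])
  have bound: "int (forms.dim (forms_radical_at M u)) \<le> 2 * int n - 2 - int r" if u: "u \<noteq> 0" for u
    unfolding dim_V[symmetric]
  proof (rule dim_two_ranks_common_radical_le[where u = u and l = l])
    show "forms_radical_at M u \<subseteq> symm_forms scale" using M_symm by (auto simp: forms_radical_at_def)
    show "form_rank scale f \<in> {r, l}" if f: "f \<in> forms_radical_at M u" "f \<noteq> 0" for f
    proof -
      have fM: "f \<in> M" and uf: "u \<in> form_radical f" using f by (auto simp: forms_radical_at_def)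
      have "f \<in> symm_forms scale" using M_symm fM by blast
      note R = card_radical[OF this]
      have "form_rank scale f \<noteq> n"
      proof
        assume "form_rank scale f = n"
        then have "card (form_radical f) = 1" using R(2) by (simp add: dim_V)
        moreover have "{0, u} \<subseteq> form_radical f"
          using uf subspace_0[OF subspace_radical[OF \<open>f \<in> symm_forms scale\<close>]] by simp
        ultimately show False using u by (auto simp: card_1_singleton_iff)
      qed
      then show ?thesis using ranks[OF fM f(2)] by blast
    qed
  qed (use u r_pos r_less_l l_less_n parity q q_neq_2 dim_V subspace_forms_radical_at[OF M_subspace]
      in \<open>auto simp: forms_radical_at_def\<close>)
  have "\<exists>u :: 'v. u \<noteq> 0"
  proof (rule ccontr)
    assume "\<nexists>u :: 'v. u \<noteq> 0"
    then have "card (UNIV :: 'v set) = 1" by (auto simp: card_1_singleton_iff)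
    moreover have "card (UNIV :: 'v set) = CARD('k) ^ n"
      using card_subspace[OF subspace_UNIV] by (simp add: dim_V)
    ultimately show False
      using one_less_power[OF field_card_gt_1[where 'k = 'k], of n] l_less_n by simp
  qed
  then obtain u :: 'v where "u \<noteq> 0" by blast
  then have "int (forms.dim M) \<le> 3 * int n - int r - 2"
    using bound dim_le_dim_radical_at[OF M_subspace M_symm, of u] dim_V by fastforce
  with bound show ?thesis by blast
qed

end
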